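(* Let $K$ be a nonempty closed convex set in $H$ and let $f,g:H\to H$ be two continuous mappings. For $\hat x\in H$ and $r>\|\Pi_K(\hat x)\|$ put $\Omega^{\hat x}_r:=\{x\in H\mid \|g(x)\|<r\}$. Suppose that (a) the boundedness of $\|g(x)\|$ implies the boundedness of $\|x\|$ (i.e. for every $M\ge 0$ the set $\{x\in H\mid \|g(x)\|\le M\}$ is bounded); and (b) for any given $\hat x\in H$ and every $r>\|\Pi_K(\hat x)\|$, the degree $\deg(g,\Omega^{\hat x}_r,\Pi_K(\hat x))$ is defined and nonzero. Then, for any given $\hat x\in H$, either GVI$(f,g,K)$ has a solution or there exists an exceptional family of elements for the pair $(f,g)$ with respect to $\hat x$.
   Context: $H$ is a finite dimensional real Hilbert space with inner product $\langle\cdot,\cdot\rangle$ and norm $\|\cdot\|$. $\Pi_K$ is the orthogonal projection onto the closed convex set $K$. The normal cone of $K$ at $z\in K$ is $\mathcal N_K(z):=\{u\in H\mid \langle u,y-z\rangle\le 0\ \forall y\in K\}$, and $\mathcal N_K(z):=\emptyset$ if $z\notin K$. GVI$(f,g,K)$ is the problem of finding $x^*\in H$ such that $g(x^* )\in K$ and $\langle f(x^* ),y-g(x^* )\rangle\ge 0$ for all $y\in K$. $\deg(\phi,\Omega,b)$ is the topological (Brouwer) degree; it is defined when $\Omega\subset H$ is bounded and open, $\phi:\bar\Omega\to H$ is continuous, and $b\notin\phi(\partial\Omega)$. Exceptional family of elements: let $g:H\to H$ and $f:D\to H$ be continuous, with $D\subseteq H$ nonempty and $g^{-1}(K)\subseteq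 D$ (here $D=H$). A set of points $\{x^r\}_{r>0}\subset D$ is an exceptional family of elements for the pair $(f,g)$ with respect to $\hat x\in H$ if (i) $\|x^r\|\to\infty$ as $r\to\infty$; (ii) $g(x^r)\in K$ for any $r>0$; (iii) for any $r>\|\Pi_K(\hat x)\|$ there exists a real number $\alpha_r>0$ such that $-[f(x^r)+\alpha_r(g(x^r)-\hat x)]\in\mathcal N_K(g(x^r))$. *)

theory Defs
  imports "HOL-Analysis.Analysis" "HOL-Homology.Homology"
begin

section \<open>Topological degree in a Euclidean space\<close>

text \<open>The triples for which the degree is defined.\<close>

definition degree_defined ::
    "('a::euclidean_space \<Rightarrow> 'a) \<Rightarrow> 'a set \<Rightarrow> 'a \<Rightarrow> bool" where
  "degree_defined \<phi> \<Omega> b \<longleftrightarrow>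
     bounded \<Omega> \<and> open \<Omega> \<and> continuous_on (closure \<Omega>) \<phi> \<and> b \<notin> \<phi> ` frontier \<Omega>"

text \<open>The library has only the degree of self-maps of spheres, so the degree of a triple is
  introduced here by its usual homological definition (Dold, Lectures on Algebraic Topology,
  IV.5 and VIII.4). Let \<open>E\<close> be the ambient space, \<open>n\<close> its dimension, and
  \<open>Z = {x \<in> \<Omega>. \<phi> x = b}\<close>, a compact subset of \<open>\<Omega>\<close>. Take a closed ball \<open>B\<close>
  around \<open>0\<close> whose interior contains \<open>\<Omega>\<close> and \<open>b\<close>. In

    \<open>H\<^sub>n(E, E - B) \<longrightarrow> H\<^sub>n(E, E - Z) \<longleftarrow> H\<^sub>n(\<Omega>, \<Omega> - Z) \<longrightarrow> H\<^sub>n(E, E - {b})\<close>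

  the first two arrows are induced by inclusions, the second is an excision isomorphism, and the
  last one is induced by \<open>\<phi>\<close>. The composite homomorphism is \<open>d\<close> times the isomorphism
  \<open>H\<^sub>n(E, E - B) \<longrightarrow> H\<^sub>n(E, E - {b})\<close> of infinite cyclic groups induced by the inclusion,
  for exactly one integer \<open>d\<close>, and this integer is the degree. As all classes \<open>c\<close> of
  \<open>H\<^sub>n(E, E - B)\<close> are considered, no generator (orientation) has to be chosen. The homology
  groups of the library are written multiplicatively, so multiplication by \<open>d\<close> is a power.\<close>

definition has_degree ::
    "('a::euclidean_space \<Rightarrow> 'a) \<Rightarrow> 'a set \<Rightarrow> 'a \<Rightarrow> int \<Rightarrow> bool" where
  "has_degree \<phi> \<Omega> b d \<longleftrightarrow>
     (let n = int DIM('a);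
          E = (euclidean :: 'a topology);
          Z = {x \<in> \<Omega>. \<phi> x = b}
      in \<forall>R. insert b \<Omega> \<subseteq> ball 0 R \<longrightarrow>
           (\<forall>c \<in> carrier (relative_homology_group n E (- cball 0 R)).
            \<forall>z \<in> carrier (relative_homology_group n (top_of_set \<Omega>) (\<Omega> - Z)).
              hom_induced n (top_of_set \<Omega>) (\<Omega> - Z) E (- Z) id z
                = hom_induced n E (- cball 0 R) E (- Z) id c
              \<longrightarrow> hom_induced n (top_of_set \<Omega>) (\<Omega> - Z) E (- {b}) \<phi> z
                = hom_induced n E (- cball 0 R) E (- {b}) id c
                    [^]\<^bsub>relative_homology_group n E (- {b})\<^esub> d))"

definition topological_degree ::
    "('a::euclidean_space \<Rightarrow> 'a) \<Rightarrow> 'a set \<Rightarrow> 'a \<Rightarrow> int" where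
  "topological_degree \<phi> \<Omega> b = (THE d. has_degree \<phi> \<Omega> b d)"

section \<open>Generalized variational inequalities\<close>

definition normal_cone :: "'a::real_inner set \<Rightarrow> 'a \<Rightarrow> 'a set" where
  "normal_cone K z = (if z \<in> K then {u. \<forall>y\<in>K. u \<bullet> (y - z) \<le> 0} else {})"

definition GVI_solution ::
    "('a::real_inner \<Rightarrow> 'a) \<Rightarrow> ('a \<Rightarrow> 'a) \<Rightarrow> 'a set \<Rightarrow> 'a \<Rightarrow> bool" where
  "GVI_solution f g K x \<longleftrightarrow> g x \<in> K \<and> (\<forall>y\<in>K. f x \<bullet> (y - g x) \<ge> 0)"

text \<open>The family is a function on the reals of which only the values at \<open>r > 0\<close> matter. For
  closed convex nonempty \<open>K\<close>, \<^const>\<open>closest_point\<close> is the orthogonal projection onto \<open>K\<close>.\<close>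

definition exceptional_family ::
    "('a::euclidean_space \<Rightarrow> 'a) \<Rightarrow> ('a \<Rightarrow> 'a) \<Rightarrow> 'a set \<Rightarrow> 'a \<Rightarrow> (real \<Rightarrow> 'a) \<Rightarrow> bool" where
  "exceptional_family f g K xhat x \<longleftrightarrow>
     filterlim (\<lambda>r. norm (x r)) at_top at_top \<and>
     (\<forall>r>0. g (x r) \<in> K) \<and>
     (\<forall>r > norm (closest_point K xhat).
        \<exists>\<alpha>>0. - (f (x r) + \<alpha> *\<^sub>R (g (x r) - xhat)) \<in> normal_cone K (g (x r)))"

end

theory Submission
  imports Defs
begin

text \<open>Assume that GVI\<open>(f,g,K)\<close> has no solution, write \<open>P\<close> for the projection onto \<open>K\<close>, and
  consider the homotopy \<open>h(t,x) = g x - P(t(g x - f x) + (1-t) xhat) + P xhat\<close> on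
  \<open>{x. \<parallel>g x\<parallel> < r}\<close>. At \<open>t = 0\<close> it is \<open>g\<close>, whose degree at \<open>P xhat\<close> is nonzero, and at
  \<open>t = 1\<close> it omits the value \<open>P xhat\<close>, because \<open>g x = P(g x - f x)\<close> says that \<open>x\<close> solves the
  problem. Hence \<open>h(t,x) = P xhat\<close> for some \<open>0 < t < 1\<close> and some \<open>x\<close> with \<open>\<parallel>g x\<parallel> = r\<close>, and
  dividing the normal cone inclusion of the projection by \<open>t\<close> gives an exceptional point with
  \<open>\<alpha> = (1-t)/t\<close>.

  Neither the existence nor the full homotopy invariance of the degree is needed for this, only
  that a map homotopic to one omitting \<open>b\<close> has degree \<open>0\<close> and no other. Uniqueness rests on a
  class of infinite order that comes from a sphere surrounding \<open>b\<close>.\<close>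

section \<open>A homology class of infinite order around a point\<close>

text \<open>The reduced group is infinite cyclic, so a generator will do. Powers are taken in the
  unreduced group because the homomorphism used below to detect infinite order lands there.\<close>

lemma infinite_order_reduced_homology_nsphere:
  obtains s where "s \<in> carrier (reduced_homology_group (int m) (nsphere m))"
    and "\<And>d::int. s [^]\<^bsub>homology_group (int m) (nsphere m)\<^esub> d
            = \<one>\<^bsub>homology_group (int m) (nsphere m)\<^esub> \<Longrightarrow> d = 0"
proof -
  let ?G = "reduced_homology_group (int m) (nsphere m)"
  let ?H = "homology_group (int m) (nsphere m)"
  interpret G: group ?G by simp
  interpret H: group ?H by simp
  obtain s where s: "s \<in> carrier ?G" and seq: "subgroup_generated ?G {s} = ?G"
    using cyclic_reduced_homology_group_nsphere [of m m] by (auto simp: cyclic_group_def)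
  \<comment> \<open>\<open>ord\<close> is 0 exactly for elements of infinite order.\<close>
  have ord: "G.ord s = 0"
    by (simp add: s seq iso_finite [OF reduced_homology_group_nsphere(1)]
        flip: G.infinite_cyclic_subgroup_order)
  show thesis
  proof
    show "s \<in> carrier ?G" by (rule s)
    fix d :: int
    assume "s [^]\<^bsub>?H\<^esub> d = \<one>\<^bsub>?H\<^esub>"
    moreover have "s [^]\<^bsub>?G\<^esub> d = s [^]\<^bsub>?H\<^esub> d"
      using s unfolding reduced_homology_group_def
      by (intro H.int_pow_subgroup_generated)
    ultimately have "s [^]\<^bsub>?G\<^esub> d = \<one>\<^bsub>?G\<^esub>"
      by (simp add: one_reduced_homology_group)
    then show "d = 0"
      using G.int_pow_eq_id [OF s] ord by simp
  qed
qed

text \<open>Up to the homeomorphism of \<open>nsphere\<close> with the unit sphere, \<open>p\<close>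
  places the sphere around \<open>b\<close> at a radius so large that it avoids \<open>S\<close>,
  and \<open>q\<close> is the radial projection from \<open>b\<close>, which undoes
  \<open>p\<close>.\<close>

lemma nsphere_retract_of_punctured_space:
  fixes b :: "'a::euclidean_space"
  assumes "bounded S" "b \<in> S"
  obtains p :: "(nat \<Rightarrow> real) \<Rightarrow> 'a" and q
  where "continuous_map (nsphere (DIM('a) - 1)) (top_of_set (- S)) p"
    and "continuous_map (top_of_set (- {b})) (nsphere (DIM('a) - 1)) q"
    and "\<And>x. x \<in> topspace (nsphere (DIM('a) - 1)) \<Longrightarrow> q (p x) = x"
proof -
  obtain u v where uv: "homeomorphic_maps (nsphere (DIM('a) - 1))
      (top_of_set (sphere 0 1 \<inter> span (Basis :: 'a set))) u v"
    by (rule homeomorphic_maps_nsphere_euclidean_sphere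
        [OF independent_Basis orthogonal_Basis refl _ norm_Basis]) auto
  then have u: "continuous_map (nsphere (DIM('a) - 1)) (top_of_set (sphere 0 1)) u"
    and v: "continuous_map (top_of_set (sphere 0 1)) (nsphere (DIM('a) - 1)) v"
    and vu: "\<And>x. x \<in> topspace (nsphere (DIM('a) - 1)) \<Longrightarrow> v (u x) = x"
    by (auto simp: homeomorphic_maps_def)
  have norm_u: "norm (u x) = 1" if "x \<in> topspace (nsphere (DIM('a) - 1))" for x
    using continuous_map_image_subset_topspace [OF u] that by auto
  obtain \<rho> where \<rho>: "\<rho> > 0" "S \<subseteq> ball b \<rho>"
    using bounded_subset_ballD [OF assms(1)] by blast
  have "continuous_map (top_of_set (sphere 0 1)) (top_of_set (- S)) (\<lambda>y. b + \<rho> *\<^sub>R y)"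
    unfolding continuous_map_in_subtopology continuous_map_iff_continuous topspace_euclidean_subtopology
  proof
    show "continuous_on (sphere 0 1) (\<lambda>y. b + \<rho> *\<^sub>R y)"
      by (intro continuous_intros)
    show "(\<lambda>y. b + \<rho> *\<^sub>R y) \<in> sphere 0 1 \<rightarrow> - S"
      using \<rho> by (force simp: dist_norm)
  qed
  from continuous_map_compose [OF u this]
  have p: "continuous_map (nsphere (DIM('a) - 1)) (top_of_set (- S)) (\<lambda>x. b + \<rho> *\<^sub>R u x)"
    by (simp add: o_def)
  have "continuous_map (top_of_set (- {b})) (top_of_set (sphere 0 1))
          (\<lambda>y. (y - b) /\<^sub>R norm (y - b))"
    unfolding continuous_map_in_subtopology continuous_map_iff_continuous topspace_euclidean_subtopology
  proof
    show "continuous_on (- {b}) (\<lambda>y. (y - b) /\<^sub>R norm (y - b))"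
      by (intro continuous_intros) auto
    show "(\<lambda>y. (y - b) /\<^sub>R norm (y - b)) \<in> - {b} \<rightarrow> sphere 0 1"
      by auto
  qed
  from continuous_map_compose [OF this v]
  have q: "continuous_map (top_of_set (- {b})) (nsphere (DIM('a) - 1))
          (\<lambda>y. v ((y - b) /\<^sub>R norm (y - b)))"
    by (simp add: o_def)
  show thesis
  proof (rule that [OF p q])
    fix x assume "x \<in> topspace (nsphere (DIM('a) - 1))"
    then show "v ((b + \<rho> *\<^sub>R u x - b) /\<^sub>R norm (b + \<rho> *\<^sub>R u x - b)) = x"
      using \<rho>(1) norm_u vu by simp
  qed
qed

text \<open>As the whole space is contractible, the sphere class pushed into \<open>- S\<close> is
  the boundary of some \<open>c\<close>. Naturality of the boundary and the map \<open>q\<close>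
  carry the image of \<open>c\<close> back to the sphere class, so this image inherits infinite
  order.\<close>

lemma infinite_order_relative_homology:
  fixes b :: "'a::euclidean_space"
  assumes S: "bounded S" "b \<in> S"
  obtains c where "c \<in> carrier (relative_homology_group (int DIM('a)) euclidean (- S))"
    and "\<And>d::int. hom_induced (int DIM('a)) euclidean (- S) euclidean (- {b}) id c
            [^]\<^bsub>relative_homology_group (int DIM('a)) euclidean (- {b})\<^esub> d
          = \<one>\<^bsub>relative_homology_group (int DIM('a)) euclidean (- {b})\<^esub> \<Longrightarrow> d = 0"
proof -
  let ?E = "euclidean :: 'a topology"
  let ?n = "int DIM('a)"
  let ?N = "nsphere (DIM('a) - 1)"
  \<comment> \<open>The natural subtraction is exact because \<open>DIM('a)\<close> is
    positive.\<close>
  have n1: "?n - 1 = int (DIM('a) - 1)"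
    by (simp add: of_nat_diff)
  obtain p :: "(nat \<Rightarrow> real) \<Rightarrow> 'a" and q
    where p: "continuous_map ?N (top_of_set (- S)) p"
      and q: "continuous_map (top_of_set (- {b})) ?N q"
      and qp: "\<And>x. x \<in> topspace ?N \<Longrightarrow> q (p x) = x"
    using nsphere_retract_of_punctured_space [OF S] by blast
  obtain s where s: "s \<in> carrier (reduced_homology_group (?n - 1) ?N)"
    and sinf: "\<And>d::int. s [^]\<^bsub>homology_group (?n - 1) ?N\<^esub> d
            = \<one>\<^bsub>homology_group (?n - 1) ?N\<^esub> \<Longrightarrow> d = 0"
    using infinite_order_reduced_homology_nsphere [of "DIM('a) - 1"] unfolding n1 by blast
  define s' where "s' = hom_induced (?n - 1) ?N {} (top_of_set (- S)) {} p s"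
  have s': "s' \<in> carrier (reduced_homology_group (?n - 1) (top_of_set (- S)))"
    unfolding s'_def by (rule hom_induced_reduced [OF s])
  have "contractible_space ?E"
    using contractible_space_top_of_set [of "UNIV :: 'a set"] contractible_UNIV
    by (metis subtopology_UNIV)
  then have triv: "trivial_group (reduced_homology_group (?n - 1) ?E)"
    by (rule trivial_reduced_homology_group_contractible_space)
  have "hom_induced (?n - 1) (top_of_set (- S)) {} ?E {} id s'
      \<in> carrier (reduced_homology_group (?n - 1) ?E)"
    by (rule hom_induced_reduced [OF s'])
  then have "s' \<in> kernel (reduced_homology_group (?n - 1) (top_of_set (- S)))
      (reduced_homology_group (?n - 1) ?E) (hom_induced (?n - 1) (top_of_set (- S)) {} ?E {} id)"
    using triv s' by (auto simp: kernel_def trivial_group_def)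
  also have "\<dots> = hom_boundary ?n ?E (- S) ` carrier (relative_homology_group ?n ?E (- S))"
    using homology_exactness_reduced_2 [of ?n ?E "- S"] by simp
  finally obtain c where c: "c \<in> carrier (relative_homology_group ?n ?E (- S))"
    and s'c: "s' = hom_boundary ?n ?E (- S) c"
    by blast
  let ?R = "relative_homology_group ?n ?E (- {b})"
  let ?i = "hom_induced ?n ?E (- S) ?E (- {b}) id"
  let ?h = "hom_induced (?n - 1) (top_of_set (- {b})) {} ?N {} q \<circ> hom_boundary ?n ?E (- {b})"
  have Sb: "id \<in> - S \<rightarrow> - {b}" using S by auto
  have h: "group_hom ?R (homology_group (?n - 1) ?N) ?h"
    unfolding group_hom_def group_hom_axioms_def
    by (auto intro: hom_compose [OF hom_boundary_hom hom_induced_hom])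
  have ic: "?i c \<in> carrier ?R"
    by (rule hom_induced_carrier)
  have "?h (?i c) = hom_induced (?n - 1) (top_of_set (- {b})) {} ?N {} q
      (hom_induced (?n - 1) (top_of_set (- S)) {} (top_of_set (- {b})) {} id s')"
    using naturality_hom_induced [OF continuous_map_id Sb, of ?n] s'c
    by (simp add: o_def fun_eq_iff)
  also have "\<dots> = hom_induced (?n - 1) ?N {} ?N {} (q \<circ> (id \<circ> p)) s"
  proof -
    have i: "continuous_map (top_of_set (- S)) (top_of_set (- {b})) id"
      using S by (auto simp: continuous_map_in_subtopology)
    show ?thesis
      unfolding s'_def hom_induced_compose_empty [OF continuous_map_compose [OF p i] q]
        hom_induced_compose_empty [OF p i] by simp
  qed
  also have "\<dots> = s"
  proof (rule hom_induced_id_gen)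
    show "continuous_map ?N ?N (q \<circ> (id \<circ> p))"
      by (rule continuous_map_eq [OF continuous_map_id]) (simp add: qp)
    show "s \<in> carrier (homology_group (?n - 1) ?N)"
      using s carrier_reduced_homology_group_subset by blast
  qed (simp add: qp)
  finally have hic: "?h (?i c) = s" .
  show thesis
  proof (rule that [OF c])
    fix d :: int
    assume "?i c [^]\<^bsub>?R\<^esub> d = \<one>\<^bsub>?R\<^esub>"
    then have "?h (?i c [^]\<^bsub>?R\<^esub> d) = \<one>\<^bsub>homology_group (?n - 1) ?N\<^esub>"
      using group_hom.hom_one [OF h] by simp
    then show "d = 0"
      using group_hom.hom_int_pow [OF h ic] hic sinf by simp
  qed
qed

text \<open>The excised set is the complement of \<Omega>: it is closed and lies in the open set
  \<open>- Z\<close>.\<close>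

lemma excision_open_closed:
  fixes \<Omega> Z :: "'a::euclidean_space set"
  assumes "open \<Omega>" "closed Z" "Z \<subseteq> \<Omega>"
  shows "hom_induced p (top_of_set \<Omega>) (\<Omega> - Z) euclidean (- Z) id
    \<in> iso (relative_homology_group p (top_of_set \<Omega>) (\<Omega> - Z))
          (relative_homology_group p euclidean (- Z))"
proof -
  have "euclidean closure_of (- \<Omega>) \<subseteq> euclidean interior_of (- Z)"
    using assms by (auto simp: interior_open closed_Compl open_Compl closure_closed)
  from homology_excision_axiom [OF this, of UNIV p]
  show ?thesis
    using assms(3) by (simp add: Compl_eq_Diff_UNIV Diff_Diff_Int Un_absorb1 Int_absorb1 double_diff)
      (metis Diff_Compl Int_commute Diff_eq Compl_eq_Diff_UNIV)
qed

section \<open>Uniqueness and vanishing of the degree\<close>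

text \<open>Fix one ball and a class \<open>c\<close> whose image over \<open>b\<close> has infinite
  order. Excision supplies a matching \<open>z\<close>, and both degrees express the image of
  \<open>z\<close> under \<phi> as a power of the image of \<open>c\<close>, so the exponents
  agree.\<close>

lemma has_degree_unique:
  fixes \<phi> :: "'a::euclidean_space \<Rightarrow> 'a"
  assumes \<Omega>: "bounded \<Omega>" "open \<Omega>" and Z: "closed {x \<in> \<Omega>. \<phi> x = b}"
    and d: "has_degree \<phi> \<Omega> b d" "has_degree \<phi> \<Omega> b d'"
  shows "d = d'"
proof -
  let ?E = "euclidean :: 'a topology"
  let ?n = "int DIM('a)"
  define Z where "Z = {x \<in> \<Omega>. \<phi> x = b}"
  obtain R where R: "insert b \<Omega> \<subseteq> ball 0 R"
    using bounded_subset_ballD [of "insert b \<Omega>" 0] \<Omega>(1) by auto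
  let ?G = "relative_homology_group ?n ?E (- {b})"
  let ?i = "hom_induced ?n ?E (- cball 0 R) ?E (- {b}) id"
  interpret G: group ?G by simp
  obtain c where c: "c \<in> carrier (relative_homology_group ?n ?E (- cball 0 R))"
    and cinf: "\<And>d::int. ?i c [^]\<^bsub>?G\<^esub> d = \<one>\<^bsub>?G\<^esub> \<Longrightarrow> d = 0"
    using infinite_order_relative_homology [of "cball 0 R" b] R by auto
  have ic: "?i c \<in> carrier ?G"
    by (rule hom_induced_carrier)
  have "hom_induced ?n (top_of_set \<Omega>) (\<Omega> - Z) ?E (- Z) id
      \<in> iso (relative_homology_group ?n (top_of_set \<Omega>) (\<Omega> - Z)) (relative_homology_group ?n ?E (- Z))"
    using \<Omega> Z by (intro excision_open_closed) (auto simp: Z_def)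
  then obtain z where z: "z \<in> carrier (relative_homology_group ?n (top_of_set \<Omega>) (\<Omega> - Z))"
    and zc: "hom_induced ?n (top_of_set \<Omega>) (\<Omega> - Z) ?E (- Z) id z
      = hom_induced ?n ?E (- cball 0 R) ?E (- Z) id c"
    by (smt (verit) hom_induced_carrier imageE iso_iff)
  have "hom_induced ?n (top_of_set \<Omega>) (\<Omega> - Z) ?E (- {b}) \<phi> z = ?i c [^]\<^bsub>?G\<^esub> e"
    if "has_degree \<phi> \<Omega> b e" for e
    using that R c z zc unfolding has_degree_def Let_def Z_def by blast
  then have "?i c [^]\<^bsub>?G\<^esub> d = ?i c [^]\<^bsub>?G\<^esub> d'"
    using d by metis
  then have "?i c [^]\<^bsub>?G\<^esub> (d - d') = \<one>\<^bsub>?G\<^esub>"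
    using G.int_pow_diff [OF ic] ic by simp
  then show ?thesis
    using cinf by fastforce
qed

text \<open>A class over \<open>\<Omega>\<close> relative to the complement of the zeros of \<open>h 0\<close> need not be
  transported along the homotopy; by excision it lifts to one relative to the complement of the
  zeros of all \<open>h t\<close>, which is.\<close>

lemma has_degree_zero:
  fixes h :: "real \<times> 'a::euclidean_space \<Rightarrow> 'a"
  assumes \<Omega>: "bounded \<Omega>" "open \<Omega>" and h: "continuous_on ({0..1} \<times> closure \<Omega>) h"
    and bdry: "\<And>t x. t \<in> {0..1} \<Longrightarrow> x \<in> frontier \<Omega> \<Longrightarrow> h (t, x) \<noteq> b"
    and one: "\<And>x. x \<in> \<Omega> \<Longrightarrow> h (1, x) \<noteq> b"
  shows "closed {x \<in> \<Omega>. h (0, x) = b}" and "has_degree (\<lambda>x. h (0, x)) \<Omega> b 0"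
proof -
  let ?E = "euclidean :: 'a topology"
  let ?n = "int DIM('a)"
  let ?\<Omega> = "top_of_set \<Omega>"
  have clo: "closure \<Omega> = \<Omega> \<union> frontier \<Omega>"
    by (simp add: closure_Un_frontier)
  \<comment> \<open>\<open>W\<close> collects the points sent to \<open>b\<close> at any time. As
    the projection of a compact set it is closed, and the boundary condition keeps it inside
    \<Omega>.\<close>
  define W where "W = snd ` {y \<in> {0..1} \<times> closure \<Omega>. h y = b}"
  define Z where "Z = {x \<in> \<Omega>. h (0, x) = b}"
  have "compact {y \<in> {0..1} \<times> closure \<Omega>. h y = b}"
  proof -
    have "compact ({0..1::real} \<times> closure \<Omega>)"
      using \<Omega>(1) by (intro compact_Times) (auto simp: compact_closure)
    moreover have "closedin (top_of_set ({0..1} \<times> closure \<Omega>)) {y \<in> {0..1} \<times> closure \<Omega>. h y = b}"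
      using continuous_closedin_preimage_constant [OF h] by blast
    ultimately show ?thesis
      by (rule closedin_compact)
  qed
  then have clW: "closed W"
    unfolding W_def
    by (intro compact_imp_closed compact_continuous_image continuous_intros)
  have W\<Omega>: "W \<subseteq> \<Omega>"
    using bdry unfolding W_def clo by fastforce
  have ZW: "Z \<subseteq> W"
    by (force simp: Z_def W_def clo)
  \<comment> \<open>The boundary condition at time 0 excludes frontier points, so \<open>Z\<close>
    is a slice of the compact set above.\<close>
  have "Z = (\<lambda>x. (0, x)) -` {y \<in> {0..1} \<times> closure \<Omega>. h y = b}"
    using bdry [of 0] by (auto simp: Z_def clo)
  moreover have "closed ((\<lambda>x::'a. (0::real, x)) -` {y \<in> {0..1} \<times> closure \<Omega>. h y = b})"
    using \<open>compact _\<close> by (intro closed_vimage compact_imp_closed continuous_intros)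
  ultimately show clZ: "closed {x \<in> \<Omega>. h (0, x) = b}"
    by (simp add: Z_def)
  have offW: "h (t, x) \<noteq> b" if "t \<in> {0..1}" "x \<in> \<Omega> - W" for t x
    using that unfolding W_def clo by force
  have "continuous_map (prod_topology (top_of_set {0..1}) ?\<Omega>) ?E h"
    using continuous_on_subset [OF h, of "{0..1} \<times> \<Omega>"] closure_subset
    by (force simp: prod_topology_subtopology_eu)
  \<comment> \<open>Off \<open>W\<close> the value \<open>b\<close> is avoided at every time, which
    makes this a homotopy of maps of pairs; off \<open>Z\<close> this is known only at time
    0.\<close>
  then have "homotopic_with (\<lambda>k. k \<in> \<Omega> - W \<rightarrow> - {b}) ?\<Omega> ?E (\<lambda>x. h (0, x)) (\<lambda>x. h (1, x))"
    unfolding homotopic_with_def using offW by (intro exI [of _ h]) auto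
  note homot = homology_homotopy_axiom [OF this, of ?n]
  have cont: "continuous_on \<Omega> (\<lambda>x. h (t, x))" if "t \<in> {0..1}" for t
    using that clo by (intro continuous_on_compose2 [OF h] continuous_intros) auto
  have triv: "trivial_group (relative_homology_group ?n (top_of_set (- {b})) (- {b}))"
    using trivial_relative_homology_group_topspace [of ?n "top_of_set (- {b})"] by simp
  show "has_degree (\<lambda>x. h (0, x)) \<Omega> b 0"
    unfolding has_degree_def Let_def Z_def [symmetric]
  proof (intro allI impI ballI)
    fix R c z
    assume R: "insert b \<Omega> \<subseteq> ball 0 R"
      and c: "c \<in> carrier (relative_homology_group ?n ?E (- cball 0 R))"
      and z: "z \<in> carrier (relative_homology_group ?n ?\<Omega> (\<Omega> - Z))"
      and zc: "hom_induced ?n ?\<Omega> (\<Omega> - Z) ?E (- Z) id z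
                = hom_induced ?n ?E (- cball 0 R) ?E (- Z) id c"
    have RW: "- cball 0 R \<subseteq> - W"
      using R W\<Omega> by fastforce
    obtain w where w: "w \<in> carrier (relative_homology_group ?n ?\<Omega> (\<Omega> - W))"
      and wc: "hom_induced ?n ?\<Omega> (\<Omega> - W) ?E (- W) id w
                = hom_induced ?n ?E (- cball 0 R) ?E (- W) id c"
      using excision_open_closed [OF \<Omega>(2) clW W\<Omega>, of ?n]
      by (smt (verit) hom_induced_carrier imageE iso_iff)
    let ?j = "hom_induced ?n ?\<Omega> (\<Omega> - W) ?\<Omega> (\<Omega> - Z) id"
    \<comment> \<open>\<open>?j w\<close> and \<open>z\<close> have the same image under the
      excision isomorphism for \<open>Z\<close>, both matching \<open>c\<close>, and are therefore
      equal.\<close>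
    have "hom_induced ?n ?\<Omega> (\<Omega> - Z) ?E (- Z) id (?j w) = hom_induced ?n ?\<Omega> (\<Omega> - W) ?E (- Z) id w"
      using ZW by (subst hom_induced_compose') auto
    also have "\<dots> = hom_induced ?n ?E (- W) ?E (- Z) id (hom_induced ?n ?\<Omega> (\<Omega> - W) ?E (- W) id w)"
      using ZW by (subst hom_induced_compose') auto
    also have "\<dots> = hom_induced ?n ?\<Omega> (\<Omega> - Z) ?E (- Z) id z"
      unfolding wc zc using ZW RW by (subst hom_induced_compose') auto
    finally have "?j w = z"
      using excision_open_closed [OF \<Omega>(2) clZ, of ?n] z
      by (auto simp: iso_iff Z_def hom_induced_carrier dest: inj_onD)
    then have "hom_induced ?n ?\<Omega> (\<Omega> - Z) ?E (- {b}) (\<lambda>x. h (0, x)) z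
      = hom_induced ?n ?\<Omega> (\<Omega> - W) ?E (- {b}) ((\<lambda>x. h (0, x)) \<circ> id) w"
      using ZW cont [of 0]
      by (subst hom_induced_compose' [symmetric, where Y = ?\<Omega> and T = "\<Omega> - Z"]) (auto simp: Z_def)
    also have "\<dots> = hom_induced ?n ?\<Omega> (\<Omega> - W) ?E (- {b}) (id \<circ> (\<lambda>x. h (1, x))) w"
      using homot by simp
    \<comment> \<open>At time 1 all of \<Omega> is mapped off \<open>b\<close>, so the induced map
      factors through the homology of a space relative to itself, which is trivial.\<close>
    also have "\<dots> = hom_induced ?n (top_of_set (- {b})) (- {b}) ?E (- {b}) id
        (hom_induced ?n ?\<Omega> (\<Omega> - W) (top_of_set (- {b})) (- {b}) (\<lambda>x. h (1, x)) w)"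
      using cont [of 1] one
      by (subst hom_induced_compose') (auto simp: continuous_map_in_subtopology)
    also have "\<dots> = \<one>\<^bsub>relative_homology_group ?n ?E (- {b})\<^esub>"
      using triv hom_one [OF hom_induced_hom]
      by (metis group_relative_homology_group hom_induced_carrier singletonD trivial_group_def)
    finally show "hom_induced ?n ?\<Omega> (\<Omega> - Z) ?E (- {b}) (\<lambda>x. h (0, x)) z
        = hom_induced ?n ?E (- cball 0 R) ?E (- {b}) id c
            [^]\<^bsub>relative_homology_group ?n ?E (- {b})\<^esub> (0::int)"
      by simp
  qed
qed

text \<open>By uniqueness 0 is the only integer satisfying \<open>has_degree\<close>, so the
  definite description selects it.\<close>

lemma topological_degree_zero:
  fixes h :: "real \<times> 'a::euclidean_space \<Rightarrow> 'a"
  assumes "bounded \<Omega>" "open \<Omega>" "continuous_on ({0..1} \<times> closure \<Omega>) h"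
    and "\<And>t x. t \<in> {0..1} \<Longrightarrow> x \<in> frontier \<Omega> \<Longrightarrow> h (t, x) \<noteq> b"
    and "\<And>x. x \<in> \<Omega> \<Longrightarrow> h (1, x) \<noteq> b"
  shows "topological_degree (\<lambda>x. h (0, x)) \<Omega> b = 0"
  unfolding topological_degree_def
proof (rule the_equality)
  show zero: "has_degree (\<lambda>x. h (0, x)) \<Omega> b 0"
    using assms by (rule has_degree_zero(2))
  have "closed {x \<in> \<Omega>. h (0, x) = b}"
    using assms by (rule has_degree_zero(1))
  then show "d = 0" if "has_degree (\<lambda>x. h (0, x)) \<Omega> b d" for d
    using has_degree_unique [OF assms(1,2) _ that zero] by simp
qed

section \<open>Normal cones and the projection homotopy\<close>

text \<open>This is the obtuse-angle property of the nearest point.\<close>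

lemma normal_cone_closest_point:
  assumes "convex K" "closed K" "K \<noteq> {}" and "z = closest_point K w"
  shows "w - z \<in> normal_cone K z"
  using assms closest_point_in_set closest_point_dot [OF assms(1,2)]
  by (auto simp: normal_cone_def)

lemma GVI_solution_iff_normal_cone:
  "GVI_solution f g K x \<longleftrightarrow> - f x \<in> normal_cone K (g x)"
  by (auto simp: GVI_solution_def normal_cone_def)

lemma normal_cone_scaleR:
  assumes "u \<in> normal_cone K z" "a \<ge> 0"
  shows "a *\<^sub>R u \<in> normal_cone K z"
  using assms by (auto simp: normal_cone_def mult_nonneg_nonpos split: if_splits)

lemma exceptional_point_on_sphere:
  fixes f g :: "'a::euclidean_space \<Rightarrow> 'a"
  assumes K: "K \<noteq> {}" "closed K" "convex K"
    and f: "continuous_on UNIV f" and g: "continuous_on UNIV g"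
    and r: "r > norm (closest_point K xhat)"
    and bounded: "bounded {x. norm (g x) < r}"
    and deg: "topological_degree g {x. norm (g x) < r} (closest_point K xhat) \<noteq> 0"
    and no: "\<And>x. \<not> GVI_solution f g K x"
  obtains x \<alpha> where "norm (g x) = r" "\<alpha> > 0"
    and "- (f x + \<alpha> *\<^sub>R (g x - xhat)) \<in> normal_cone K (g x)"
proof -
  let ?\<Omega> = "{x. norm (g x) < r}"
  define P where "P = closest_point K"
  define w where "w = (\<lambda>t x. t *\<^sub>R (g x - f x) + (1 - t) *\<^sub>R xhat)"
  \<comment> \<open>Adding \<open>P xhat\<close> makes \<open>h\<close> start at \<open>g\<close>
    itself, while \<open>h (t, x) = P xhat\<close> still means
    \<open>g x = P (w t x)\<close>.\<close>
  define h where "h = (\<lambda>(t, x). g x - P (w t x) + P xhat)"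
  have opn: "open ?\<Omega>"
    by (intro open_Collect_less continuous_on_norm g continuous_on_const)
  have "closure ?\<Omega> \<subseteq> {x. norm (g x) \<le> r}"
    by (intro closure_minimal closed_Collect_le continuous_on_norm g continuous_on_const) auto
  \<comment> \<open>Frontier points lie in the closure, where the norm is at most \<open>r\<close>,
    but outside the open set itself.\<close>
  then have fr: "norm (g x) = r" if "x \<in> frontier ?\<Omega>" for x
    using that opn by (force simp: frontier_def interior_open)
  have P: "continuous_on S P" for S
    unfolding P_def using K by (intro continuous_on_closest_point)
  have gs: "continuous_on S (\<lambda>y. g (snd y))" and fs: "continuous_on S (\<lambda>y. f (snd y))"
    for S :: "(real \<times> 'a) set"
    using f g by (auto intro!: continuous_on_compose2 [where f = snd] continuous_intros)
  have "continuous_on S h" for S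
    unfolding h_def w_def case_prod_unfold
    by (intro continuous_intros gs fs continuous_on_compose2 [OF P [of UNIV]]) auto
  moreover have one: "h (1, x) \<noteq> P xhat" for x
  proof
    assume "h (1, x) = P xhat"
    then have "g x = closest_point K (g x - f x)"
      by (simp add: h_def w_def P_def)
    from normal_cone_closest_point [OF K(3,2,1) this] no [of x] show False
      by (simp add: GVI_solution_iff_normal_cone)
  qed
  moreover have "(\<lambda>x. h (0, x)) = g"
    by (simp add: h_def w_def)
  \<comment> \<open>If \<open>h\<close> avoided \<open>P xhat\<close> on the frontier at all times,
    the degree of \<open>g\<close> would be 0.\<close>
  ultimately obtain t x where t: "t \<in> {0..1}" and x: "x \<in> frontier ?\<Omega>"
    and tx: "h (t, x) = P xhat"
    using topological_degree_zero [OF bounded opn, of h "P xhat"] deg unfolding P_def by metis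
  have gx: "g x = closest_point K (w t x)"
    using tx by (simp add: h_def P_def)
  have "t \<noteq> 1"
    using one tx by auto
  \<comment> \<open>At \<open>t = 0\<close> the point \<open>g x\<close> would be
    \<open>P xhat\<close>, of norm less than \<open>r\<close>.\<close>
  moreover have "t \<noteq> 0"
    using gx fr [OF x] r by (auto simp: w_def)
  ultimately have t01: "0 < t" "t < 1"
    using t by auto
  have "(1 / t) *\<^sub>R (w t x - g x) \<in> normal_cone K (g x)"
    using normal_cone_scaleR [OF normal_cone_closest_point [OF K(3,2,1) gx], of "1 / t"] t01 by simp
  also have "(1 / t) *\<^sub>R (w t x - g x) = - (f x + ((1 - t) / t) *\<^sub>R (g x - xhat))"
  proof -
    have "w t x - g x = - (t *\<^sub>R f x + (1 - t) *\<^sub>R (g x - xhat))"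
      by (simp add: w_def algebra_simps)
    then show ?thesis
      using t01 by (simp add: scaleR_add_right scaleR_diff_right)
  qed
  finally show thesis
    using that [of x "(1 - t) / t"] fr [OF x] t01 by simp
qed

theorem mainTheorem1:
  fixes f g :: "'a::euclidean_space \<Rightarrow> 'a" and K :: "'a set"
  assumes "K \<noteq> {}" and "closed K" and "convex K"
    and "continuous_on UNIV f" and "continuous_on UNIV g"
    and "\<And>M. M \<ge> 0 \<Longrightarrow> bounded {x. norm (g x) \<le> M}"
    and "\<And>xhat r. r > norm (closest_point K xhat) \<Longrightarrow>
           degree_defined g {x. norm (g x) < r} (closest_point K xhat) \<and>
           topological_degree g {x. norm (g x) < r} (closest_point K xhat) \<noteq> 0"
  shows "\<forall>xhat. (\<exists>x. GVI_solution f g K x) \<or> (\<exists>x. exceptional_family f g K xhat x)"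
proof (intro allI disjCI)
  fix xhat
  let ?r = "norm (closest_point K xhat)"
  assume "\<not> (\<exists>x. exceptional_family f g K xhat x)"
  show "\<exists>x. GVI_solution f g K x"
  proof (rule ccontr)
    assume no: "\<not> (\<exists>x. GVI_solution f g K x)"
    have "\<exists>x. norm (g x) = r \<and> (\<exists>\<alpha>>0. - (f x + \<alpha> *\<^sub>R (g x - xhat)) \<in> normal_cone K (g x))"
      if "r > ?r" for r
      using exceptional_point_on_sphere [OF assms(1-5) that, of thesis for thesis]
        assms(7) [OF that] no unfolding degree_defined_def by blast
    then obtain X where X: "\<And>r. r > ?r \<Longrightarrow> norm (g (X r)) = r"
      "\<And>r. r > ?r \<Longrightarrow> \<exists>\<alpha>>0. - (f (X r) + \<alpha> *\<^sub>R (g (X r) - xhat)) \<in> normal_cone K (g (X r))"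
      by metis
    have XK: "g (X r) \<in> K" if "r > ?r" for r
      using X(2) [OF that] by (auto simp: normal_cone_def split: if_splits)
    \<comment> \<open>\<open>X\<close> is controlled only beyond \<open>?r\<close>, but membership
      in \<open>K\<close> is required for all positive radii; smaller radii reuse the point for
      \<open>?r + 1\<close>.\<close>
    define Y where "Y = (\<lambda>r. X (if r > ?r then r else ?r + 1))"
    have "exceptional_family f g K xhat Y"
      unfolding exceptional_family_def
    proof (intro conjI allI impI)
      show "filterlim (\<lambda>r. norm (Y r)) at_top at_top"
        unfolding filterlim_at_top
      proof
        fix M
        \<comment> \<open>By continuity \<open>g\<close> is bounded by some \<open>C\<close> on the
          ball of radius \<open>M\<close>, so a point with \<open>norm (g (Y r)) = r > C\<close>
          lies outside that ball.\<close>
        have "bounded (g ` cball 0 M)"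
          using assms(5) by (intro compact_imp_bounded compact_continuous_image)
            (auto intro: continuous_on_subset)
        then obtain C where C: "\<And>x. norm x \<le> M \<Longrightarrow> norm (g x) \<le> C"
          by (force simp: bounded_iff)
        show "\<forall>\<^sub>F r in at_top. M \<le> norm (Y r)"
          using eventually_gt_at_top [of ?r] eventually_gt_at_top [of C]
        proof eventually_elim
          case (elim r)
          then show ?case
            using C [of "Y r"] X(1) [of r] by (force simp: Y_def)
        qed
      qed
      show "g (Y r) \<in> K" for r
        using XK by (simp add: Y_def)
      show "\<exists>\<alpha>>0. - (f (Y r) + \<alpha> *\<^sub>R (g (Y r) - xhat)) \<in> normal_cone K (g (Y r))" if "r > ?r" for r
        using X(2) [OF that] that by (simp add: Y_def)
    qed
    then show False
      using \<open>\<not> (\<exists>x. exceptional_family f g K xhat x)\<close> by blast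
  qed
qed

end
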